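(* For every integer $n>6$, the Catalan number $C_n$ has at least one prime factor $p$ of the form $p=6k-1$ for some positive integer $k$.
   Context: The Catalan numbers are indexed so that $C_1=1$ and $C_n=\frac{1}{n}\binom{2n-2}{n-1}$ for $n\ge 1$ (so $C_1=1, C_2=1, C_3=2, C_4=5, C_5=14, C_6=42, C_7=132,\dots$). *)

theory Defs
  imports Complex_Main "HOL-Computational_Algebra.Primes"
begin

text \<open>
  Catalan numbers with the shifted indexing \<open>C\<^sub>1 = C\<^sub>2 = 1, C\<^sub>3 = 2, C\<^sub>4 = 5\<close>; only
  indices \<open>n \<ge> 1\<close> are meaningful. The natural-number division is exact, see
  \<open>catalan_mult\<close> and \<open>of_nat_catalan\<close>.
\<close>

definition catalan :: "nat \<Rightarrow> nat" where
  "catalan n = ((2 * n - 2) choose (n - 1)) div n"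

lemma dvd_central_binomial:
  assumes "n \<ge> 1"
  shows "n dvd ((2 * n - 2) choose (n - 1))"
proof -
  obtain m where n: "n = Suc m"
    using assms by (cases n) auto
  have "Suc m * ((2 * m) choose Suc m) = m * ((2 * m) choose m)"
    using binomial_absorb_comp[of "2 * m" m] binomial_absorption[of m "2 * m"]
    by (simp add: mult_2)
  then have "Suc m dvd m * ((2 * m) choose m)"
    by (metis dvd_triv_left)
  moreover have "coprime (Suc m) m"
    by simp
  ultimately have "Suc m dvd ((2 * m) choose m)"
    using coprime_dvd_mult_right_iff by blast
  then show ?thesis
    by (simp add: n)
qed

lemma catalan_mult:
  assumes "n \<ge> 1"
  shows "n * catalan n = (2 * n - 2) choose (n - 1)"
  using dvd_central_binomial[OF assms] by (simp add: catalan_def)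

lemma of_nat_catalan:
  assumes "n \<ge> 1"
  shows "real (catalan n) = 1 / real n * real ((2 * n - 2) choose (n - 1))"
proof -
  have "real n * real (catalan n) = real ((2 * n - 2) choose (n - 1))"
    using catalan_mult[OF assms] by (metis of_nat_mult)
  then show ?thesis
    using assms by (simp add: field_simps)
qed

end

theory Submission
  imports Defs "HOL-Number_Theory.Prime_Powers" "HOL-Library.Discrete_Functions"
begin

text \<open>
  Let \<open>N = 2 * m\<close> with \<open>m = n - 1\<close>, and let \<open>\<chi>\<close> be the nontrivial character modulo 3. Summing
  \<open>\<chi> k * ln k\<close> over \<open>k \<le> x\<close> gives at most \<open>ln x\<close>, since the terms nearly cancel in pairs; expanded
  over prime powers, the sum is \<open>\<Sum>d. \<Lambda> d * \<chi> d * [x div d \<equiv> 1 (mod 3)]\<close>. So in the corresponding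
  intervals the primes \<open>\<equiv> 1 (mod 3)\<close> weigh no more than the primes \<open>\<equiv> 2 (mod 3)\<close>, up to small errors.
  A prime above \<open>sqrt N\<close> divides \<open>N choose m\<close> when \<open>N div p\<close> is odd. If no prime \<open>\<equiv> 5 (mod 6)\<close>
  divides \<open>C\<^sub>n\<close>, then \<open>N div p\<close> is even for every large prime \<open>p \<equiv> 2 (mod 3)\<close> not dividing \<open>n\<close>, and the
  inequalities for \<open>x = N\<close> and \<open>x = N div 3\<close> bound the contribution of the primes \<open>\<equiv> 1 (mod 3)\<close> to
  \<open>N choose m\<close> by that of the primes with \<open>N div p = 4\<close> or \<open>N div p \<ge> 9\<close>. Chebyshev's bound shows
  that this is too small for a number of size about \<open>2 ^ N\<close>. For \<open>m < 48000\<close> a chain of primes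
  \<open>\<equiv> 5 (mod 6)\<close> puts one of them in \<open>(m + 1, 2 * m]\<close>, where it divides \<open>C\<^sub>n\<close>.
\<close>

subsection \<open>Chebyshev estimates\<close>

lemma sum_ln_primes_dvd_le:
  fixes M :: nat
  assumes "M > 0" and "\<And>p. p \<in> A \<Longrightarrow> prime p \<and> p dvd M"
  shows "(\<Sum>p\<in>A. ln (real p)) \<le> ln (real M)"
proof -
  have fin: "finite {d. d dvd M}"
    using assms(1) by simp
  have "(\<Sum>p\<in>A. ln (real p)) = (\<Sum>p\<in>A. mangoldt p)"
    using assms(2) by (intro sum.cong) auto
  also have "\<dots> \<le> (\<Sum>d | d dvd M. mangoldt d)"
    using assms(2) fin by (intro sum_mono2) (auto intro: mangoldt_nonneg)
  also have "\<dots> = ln (real M)"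
    using mangoldt_sum[of M, where 'a = real] assms(1) by simp
  finally show ?thesis .
qed

text \<open>The two middle entries of row \<open>2 * k + 1\<close> are equal, and together they are
  at most the row sum \<open>2 * 4 ^ k\<close>.\<close>

lemma central_binomial_odd_le: "(2 * k + 1) choose k \<le> 4 ^ k"
proof -
  have "2 * ((2 * k + 1) choose k) = (\<Sum>i\<in>{k, Suc k}. (2 * k + 1) choose i)"
    using central_binomial_odd[of "2 * k + 1"] by simp
  also have "\<dots> \<le> (\<Sum>i\<le>2 * k + 1. (2 * k + 1) choose i)"
    by (intro sum_mono2) auto
  also have "\<dots> = 2 * 4 ^ k"
    by (simp only: choose_row_sum) (simp add: power_mult)
  finally show ?thesis
    by simp
qed

text \<open>Each of these primes divides \<open>(2 * k + 1)!\<close> but neither \<open>k!\<close>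
  nor \<open>(k + 1)!\<close>, so it divides the binomial coefficient bounded above.\<close>

lemma sum_ln_primes_doubling_le:
  "(\<Sum>p | prime p \<and> k + 1 < p \<and> p \<le> 2 * k + 1. ln (real p)) \<le> real k * ln 4"
proof -
  have "p dvd (2 * k + 1) choose k" if p: "prime p" "k + 1 < p" "p \<le> 2 * k + 1" for p
  proof -
    have "p dvd fact k * fact (2 * k + 1 - k) * ((2 * k + 1) choose k)"
      using p by (subst binomial_fact_lemma) (auto simp: prime_dvd_fact_iff simp del: fact_Suc)
    moreover have "\<not> p dvd fact k" "\<not> p dvd fact (2 * k + 1 - k)"
      using p by (auto simp: prime_dvd_fact_iff simp del: fact_Suc)
    ultimately show ?thesis
      using p(1) by (metis prime_dvd_mult_iff)
  qed
  then have "(\<Sum>p | prime p \<and> k + 1 < p \<and> p \<le> 2 * k + 1. ln (real p)) 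
      \<le> ln (real ((2 * k + 1) choose k))"
    by (intro sum_ln_primes_dvd_le) auto
  also have "\<dots> \<le> ln (real (4 ^ k))"
    using central_binomial_odd_le[of k] by (subst ln_le_cancel_iff) (auto simp del: of_nat_power)
  finally show ?thesis
    by (simp add: ln_realpow)
qed

text \<open>Chebyshev's bound by strong induction: an even \<open>n > 2\<close> is not prime, and an
  odd \<open>n = 2 * k + 1\<close> is split at \<open>k + 1\<close>, the upper half being the
  doubling bound.\<close>

lemma sum_ln_primes_le: "(\<Sum>p | prime p \<and> p \<le> n. ln (real p)) \<le> real n * ln 4"
proof (induction n rule: less_induct)
  case (less n)
  consider "n \<le> 1" | "n = 2" | "n > 2" "even n" | k where "n = 2 * k + 1" "k > 0"
  proof (cases "even n \<or> n \<le> 1")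
    case True
    then show ?thesis
      using that(1-3) by fastforce
  next
    case False
    then obtain k where "n = 2 * k + 1"
      by (auto elim: oddE)
    then show ?thesis
      using that(4) False by simp
  qed
  then show ?case
  proof cases
    case 1
    then have "{p. prime p \<and> p \<le> n} = {}"
      by (auto dest: prime_gt_1_nat)
    then show ?thesis
      by (simp only: sum.empty) simp
  next
    case 2
    then have "{p. prime p \<and> p \<le> n} = {2}"
      by (auto dest: prime_ge_2_nat)
    moreover have "ln 2 \<le> 2 * ln (4 :: real)"
      by (rule order_trans[of _ "ln 4"]) simp_all
    ultimately show ?thesis
      using 2 by simp
  next
    case 3
    then have "\<not> prime n"
      using primes_dvd_imp_eq two_is_prime_nat by blast
    then have "p \<le> n \<longleftrightarrow> p \<le> n - 1" if "prime p" for p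
      using that by (cases "p = n") auto
    then have "{p. prime p \<and> p \<le> n} = {p. prime p \<and> p \<le> n - 1}"
      by blast
    then have "(\<Sum>p | prime p \<and> p \<le> n. ln (real p)) \<le> real (n - 1) * ln 4"
      using less.IH[of "n - 1"] 3 by (simp only:)
    also have "\<dots> \<le> real n * ln 4"
      by (intro mult_right_mono) auto
    finally show ?thesis .
  next
    case (4 k)
    have "{p. prime p \<and> p \<le> n} =
        {p. prime p \<and> p \<le> k + 1} \<union> {p. prime p \<and> k + 1 < p \<and> p \<le> 2 * k + 1}"
      using 4 by auto
    then have "(\<Sum>p | prime p \<and> p \<le> n. ln (real p)) = (\<Sum>p | prime p \<and> p \<le> k + 1. ln (real p))
        + (\<Sum>p | prime p \<and> k + 1 < p \<and> p \<le> 2 * k + 1. ln (real p))"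
      by (simp only:) (intro sum.union_disjoint, auto)
    also have "\<dots> \<le> real (k + 1) * ln 4 + real k * ln 4"
      using 4 by (intro add_mono less.IH sum_ln_primes_doubling_le) auto
    also have "\<dots> = real n * ln 4"
      using 4 by (simp add: algebra_simps)
    finally show ?thesis .
  qed
qed

subsection \<open>Sums over prime powers\<close>

text \<open>A prime power \<open>p ^ i\<close> counted here has \<open>p \<le> s\<close>, since
  \<open>i \<ge> 2\<close> forces \<open>p ^ 2 \<le> N\<close>. The powers of one such
  \<open>p\<close> up to \<open>N\<close> weigh at most \<open>ln N\<close> in total, and there are
  at most \<open>s\<close> bases.\<close>

lemma sum_mangoldt_small_le:
  assumes N: "N > 0" "N < (s + 1)\<^sup>2"
  shows "(\<Sum>d | d \<in> {1..N} \<and> \<not> (prime d \<and> s < d). mangoldt d) \<le> real s * ln (real N)"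
proof -
  define P where "P = {p. prime p \<and> p \<le> s}"
  define L where "L p = {i. i > 0 \<and> p ^ i \<le> N}" for p
  have P1: "p > 1" if "p \<in> P" for p
    using that by (auto simp: P_def dest: prime_gt_1_nat)
  have finP: "finite P" and cardP: "card P \<le> s"
  proof -
    have "P \<subseteq> {1..s}"
      by (auto simp: P_def Suc_le_eq prime_gt_0_nat)
    then show "finite P" "card P \<le> s"
      using card_mono[of "{1..s}" P] finite_subset by auto
  qed
  have L_fin: "finite (L p)" if "p \<in> P" for p
  proof (rule finite_subset)
    show "L p \<subseteq> {..N}"
      using power_gt_expt[of p] P1[OF that] by (auto simp: L_def intro: less_imp_le less_le_trans)
  qed auto
  have L_bound: "real (card (L p)) * ln (real p) \<le> ln (real N)" if p: "p \<in> P" for p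
  proof (cases "L p = {}")
    case True
    then show ?thesis
      using N by simp
  next
    case False
    define M where "M = Max (L p)"
    have "M \<in> L p"
      unfolding M_def using False L_fin[OF p] by (intro Max_in)
    moreover have "L p \<subseteq> {1..M}"
      using Max_ge[OF L_fin[OF p]] by (auto simp: M_def L_def)
    ultimately have M: "M \<in> L p" "L p \<subseteq> {1..M}" .
    have "p ^ card (L p) \<le> p ^ M"
      using card_mono[OF _ M(2)] P1[OF p] by (intro power_increasing) auto
    also have "\<dots> \<le> N"
      using M(1) by (simp add: L_def)
    finally have "ln (real (p ^ card (L p))) \<le> ln (real N)"
      using P1[OF p] N by (subst ln_le_cancel_iff) (auto simp del: of_nat_power)
    then show ?thesis
      using P1[OF p] by (simp add: ln_realpow)
  qed
  let ?D = "{d. d \<in> {1..N} \<and> \<not> (prime d \<and> s < d)}"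
  have "(\<Sum>d\<in>?D. mangoldt d) = (\<Sum>d\<in>?D \<inter> {d. primepow d}. mangoldt d :: real)"
    by (intro sum.mono_neutral_right) (auto simp: mangoldt_def)
  also have "\<dots> \<le> (\<Sum>d\<in>(\<lambda>(p, i). p ^ i) ` (SIGMA p:P. L p). mangoldt d)"
  proof (intro sum_mono2 mangoldt_nonneg)
    show "finite ((\<lambda>(p, i). p ^ i) ` (SIGMA p:P. L p))"
      using finP L_fin by auto
    show "?D \<inter> {d. primepow d} \<subseteq> (\<lambda>(p, i). p ^ i) ` (SIGMA p:P. L p)"
    proof
      fix d assume d: "d \<in> ?D \<inter> {d. primepow d}"
      then obtain p i where pi: "prime p" "i > 0" "d = p ^ i"
        by (auto simp: primepow_def)
      have "p \<le> s"
      proof (cases "i = 1")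
        case True
        then show ?thesis
          using d pi by auto
      next
        case False
        then have "p\<^sup>2 \<le> d"
          using pi prime_gt_0_nat[OF pi(1)] by (auto intro!: power_increasing)
        also have "\<dots> < (s + 1)\<^sup>2"
          using d N by auto
        finally show ?thesis
          using power_less_imp_less_base[of p 2 "s + 1"] by simp
      qed
      then show "d \<in> (\<lambda>(p, i). p ^ i) ` (SIGMA p:P. L p)"
        using d pi by (auto simp: P_def L_def image_iff intro!: bexI[of _ "(p, i)"])
    qed
  qed
  also have "\<dots> \<le> (\<Sum>(p, i)\<in>(SIGMA p:P. L p). mangoldt (p ^ i))"
    using finP L_fin sum_image_le[of "SIGMA p:P. L p" mangoldt "\<lambda>(p, i). p ^ i"] mangoldt_nonneg
    by (auto simp: case_prod_unfold o_def)
  also have "\<dots> = (\<Sum>p\<in>P. \<Sum>i\<in>L p. mangoldt (p ^ i))"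
    using finP L_fin by (subst sum.Sigma) auto
  also have "\<dots> = (\<Sum>p\<in>P. real (card (L p)) * ln (real p))"
    by (intro sum.cong refl) (auto simp: P_def L_def)
  also have "\<dots> \<le> (\<Sum>p\<in>P. ln (real N))"
    by (intro sum_mono L_bound)
  also have "\<dots> \<le> real s * ln (real N)"
    using cardP N by (auto intro!: mult_right_mono)
  finally show ?thesis .
qed

lemma sum_mangoldt_large_primes:
  fixes w :: "nat \<Rightarrow> real"
  assumes "N > 0" "N < (s + 1)\<^sup>2" and w: "\<And>d. \<bar>w d\<bar> \<le> 1"
  shows "\<bar>(\<Sum>d=1..N. mangoldt d * w d) - (\<Sum>p | prime p \<and> s < p \<and> p \<le> N. w p * ln (real p))\<bar>
    \<le> real s * ln (real N)"
proof -
  let ?D = "{d. d \<in> {1..N} \<and> \<not> (prime d \<and> s < d)}"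
  let ?Q = "{p. prime p \<and> s < p \<and> p \<le> N}"
  have split: "{1..N} = ?Q \<union> ?D"
    by (auto simp: Suc_le_eq prime_gt_0_nat)
  have "(\<Sum>d=1..N. mangoldt d * w d) = (\<Sum>d\<in>?Q. mangoldt d * w d) + (\<Sum>d\<in>?D. mangoldt d * w d)"
    by (subst split, intro sum.union_disjoint) auto
  also have "(\<Sum>d\<in>?Q. mangoldt d * w d) = (\<Sum>p\<in>?Q. w p * ln (real p))"
    by (intro sum.cong) (auto simp: mult.commute)
  finally have "\<bar>(\<Sum>d=1..N. mangoldt d * w d) - (\<Sum>p\<in>?Q. w p * ln (real p))\<bar>
      = \<bar>\<Sum>d\<in>?D. mangoldt d * w d\<bar>"
    by simp
  also have "\<dots> \<le> (\<Sum>d\<in>?D. \<bar>mangoldt d * w d\<bar>)"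
    by (rule sum_abs)
  also have "\<dots> \<le> (\<Sum>d\<in>?D. mangoldt d)"
    using w mangoldt_nonneg by (intro sum_mono) (auto simp: abs_mult intro!: mult_left_le)
  also have "\<dots> \<le> real s * ln (real N)"
    by (rule sum_mangoldt_small_le) fact+
  finally show ?thesis .
qed

text \<open>Expand \<open>ln n\<close> as the sum of \<open>mangoldt d\<close> over
  \<open>d dvd n\<close> and exchange the sums. Terms with \<open>d > x\<close> vanish, so different
  \<open>x\<close> can share the range \<open>{1..N}\<close>.\<close>

lemma sum_ln_eq_sum_mangoldt:
  fixes f :: "nat \<Rightarrow> real"
  assumes "x \<le> N"
  shows "(\<Sum>n=1..x. f n * ln (real n)) = (\<Sum>d=1..N. mangoldt d * (\<Sum>k=1..x div d. f (k * d)))"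
proof -
  have "(\<Sum>n=1..x. f n * ln (real n)) = (\<Sum>n=1..x. \<Sum>d | d dvd n. f n * mangoldt d)"
    using mangoldt_sum[where 'a = real] by (intro sum.cong refl) (auto simp flip: sum_distrib_left)
  also have "\<dots> = (\<Sum>n=1..x. \<Sum>d\<in>{d\<in>{1..N}. d dvd n}. f n * mangoldt d)"
  proof (intro sum.cong refl)
    fix n assume "n \<in> {1..x}"
    then show "{d. d dvd n} = {d\<in>{1..N}. d dvd n}"
      using assms by (auto dest: dvd_imp_le intro!: Suc_leI Nat.gr0I)
  qed
  also have "\<dots> = (\<Sum>d=1..N. \<Sum>n\<in>{n\<in>{1..x}. d dvd n}. f n * mangoldt d)"
    by (rule sum.swap_restrict) auto
  also have "\<dots> = (\<Sum>d=1..N. mangoldt d * (\<Sum>k=1..x div d. f (k * d)))"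
  proof (intro sum.cong refl)
    fix d assume d: "d \<in> {1..N}"
    have "(\<Sum>n\<in>{n\<in>{1..x}. d dvd n}. f n * mangoldt d) = (\<Sum>k=1..x div d. f (k * d) * mangoldt d)"
      using d by (intro sum.reindex_bij_witness[of _ "\<lambda>k. k * d" "\<lambda>n. n div d"])
        (auto simp: div_le_mono less_eq_div_iff_mult_less_eq Suc_le_eq dvd_imp_le div_greater_zero_iff)
    then show "(\<Sum>n\<in>{n\<in>{1..x}. d dvd n}. f n * mangoldt d) = mangoldt d * (\<Sum>k=1..x div d. f (k * d))"
      by (simp add: sum_distrib_left mult.commute)
  qed
  finally show ?thesis .
qed

subsection \<open>The character modulo 3\<close>

definition chi3 :: "nat \<Rightarrow> real" where
  "chi3 n = (if n mod 3 = 1 then 1 else if n mod 3 = 2 then - 1 else 0)"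

lemma chi3_mult: "chi3 (a * b) = chi3 a * chi3 b"
proof -
  have "a mod 3 = 0 \<or> a mod 3 = 1 \<or> a mod 3 = 2" "b mod 3 = 0 \<or> b mod 3 = 1 \<or> b mod 3 = 2"
    by linarith+
  then show ?thesis
    unfolding chi3_def mod_mult_eq[of a 3 b, symmetric] by auto
qed

definition chi3_sum :: "nat \<Rightarrow> real" where
  "chi3_sum y = of_bool (y mod 3 = 1)"

lemma sum_chi3: "(\<Sum>k=1..y. chi3 k) = chi3_sum y"
proof (induction y)
  case (Suc y)
  then show ?case
    by (auto simp: chi3_def chi3_sum_def mod_Suc)
qed (simp add: chi3_sum_def)

lemma sum_chi3_ln_le:
  assumes "x > 0"
  shows "(\<Sum>n=1..x. chi3 n * ln (real n)) \<le> ln (real x)"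
proof -
  \<comment> \<open>The terms at \<open>3 * j + 1\<close> and \<open>3 * j + 2\<close> add up to at
    most 0, so a positive part can survive only directly after a term congruent to 1; this sharper
    form carries the induction.\<close>
  have "(\<Sum>n=1..x. chi3 n * ln (real n)) \<le> (if x mod 3 = 1 then ln (real x) else 0)" for x
  proof (induction x)
    case (Suc x)
    have "ln (real x) \<le> ln (real (Suc x))" if "x > 0"
      using that by (subst ln_le_cancel_iff) auto
    moreover have "x > 0" if "x mod 3 = 1"
      using that by (cases x) auto
    ultimately have "ln (real x) \<le> ln (real (Suc x))" if "x mod 3 = 1"
      using that by blast
    with Suc have "(\<Sum>n=1..x. chi3 n * ln (real n)) \<le> (if x mod 3 = 1 then ln (real (Suc x)) else 0)"
      by (auto split: if_splits intro: order_trans simp del: of_nat_Suc)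
    then show ?case
      by (cases "x mod 3 = 1") (auto simp: chi3_def mod_Suc split: if_splits)
  qed simp
  from this[of x] show ?thesis
    using assms by (auto split: if_splits intro: order_trans[OF _ ln_ge_zero])
qed

text \<open>By multiplicativity the multiples of \<open>d\<close> contribute
  \<open>chi3 d * chi3_sum (x div d)\<close>. The factor \<open>s\<close> pays for the terms that
  are not primes above \<open>s\<close>, the extra 1 for the character sum itself.\<close>

lemma sum_chi3_primes_le:
  assumes N: "N > 0" "N < (s + 1)\<^sup>2" and x: "x > 0" "x \<le> N"
  shows "(\<Sum>p | prime p \<and> s < p \<and> p \<le> N. chi3 p * chi3_sum (x div p) * ln (real p))
    \<le> (real s + 1) * ln (real N)"
proof -
  have "(\<Sum>n=1..x. chi3 n * ln (real n)) = (\<Sum>d=1..N. mangoldt d * (chi3 d * chi3_sum (x div d)))"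
    using x by (subst sum_ln_eq_sum_mangoldt)
      (auto simp: chi3_mult simp flip: sum_chi3 intro!: sum.cong simp: sum_distrib_left mult.commute)
  moreover have "\<bar>(\<Sum>d=1..N. mangoldt d * (chi3 d * chi3_sum (x div d))) -
      (\<Sum>p | prime p \<and> s < p \<and> p \<le> N. (chi3 p * chi3_sum (x div p)) * ln (real p))\<bar> \<le> real s * ln (real N)"
    by (intro sum_mangoldt_large_primes N) (auto simp: chi3_def chi3_sum_def)
  moreover have "(\<Sum>n=1..x. chi3 n * ln (real n)) \<le> ln (real N)"
    using sum_chi3_ln_le[of x] x by (auto intro: order_trans)
  ultimately show ?thesis
    by (simp add: algebra_simps)
qed

subsection \<open>The central binomial coefficient\<close>

lemma ln_fact_eq: "ln (fact n :: real) = (\<Sum>k=1..n. ln (real k))"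
  by (induction n) (auto simp: ln_mult add.commute)

text \<open>In the expansion of \<open>ln\<close> of the factorials, \<open>mangoldt d\<close> gets
  the weight \<open>2 * m div d - 2 * (m div d)\<close>, which is the parity of
  \<open>2 * m div d\<close>.\<close>

lemma ln_central_binomial_le:
  assumes "m > 0" "2 * m < (s + 1)\<^sup>2"
  shows "ln (real ((2 * m) choose m)) \<le>
    (\<Sum>p | prime p \<and> s < p \<and> p \<le> 2 * m. of_bool (odd (2 * m div p)) * ln (real p))
      + real s * ln (real (2 * m))"
proof -
  have fact_eq: "ln (fact x :: real) = (\<Sum>d=1..2 * m. mangoldt d * real (x div d))" if "x \<le> 2 * m" for x
    using sum_ln_eq_sum_mangoldt[of x "2 * m" "\<lambda>_. 1"] that by (simp add: ln_fact_eq)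
  have "fact (2 * m) = fact m * fact m * real ((2 * m) choose m)"
    using binomial_fact_lemma[of m "2 * m"]
    by (metis (no_types, lifting) diff_add_inverse le_add1 mult_2 of_nat_fact of_nat_mult)
  then have "ln (fact (2 * m)) = 2 * ln (fact m) + ln (real ((2 * m) choose m))"
    by (simp add: ln_mult)
  then have "ln (real ((2 * m) choose m)) =
      (\<Sum>d=1..2 * m. mangoldt d * (real (2 * m div d) - 2 * real (m div d)))"
    by (simp add: fact_eq right_diff_distrib sum_subtractf sum_distrib_left mult.left_commute)
  also have "\<dots> = (\<Sum>d=1..2 * m. mangoldt d * of_bool (odd (2 * m div d)))"
  proof (intro sum.cong refl)
    fix d assume "d \<in> {1..2 * m}"
    have parity: "q = 2 * (q div 2) + of_bool (odd q)" for q :: nat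
      by (cases "even q") simp_all
    have "2 * m div d div 2 = (2 * m) div (2 * d)"
      by (simp only: div_mult2_eq[symmetric] mult.commute[of d])
    then have "2 * m div d div 2 = m div d"
      by simp
    with parity[of "2 * m div d"] have "2 * m div d = 2 * (m div d) + of_bool (odd (2 * m div d))"
      by (simp only:)
    then have "real (2 * m div d) = 2 * real (m div d) + of_bool (odd (2 * m div d))"
      by (metis of_nat_add of_nat_mult of_nat_numeral of_nat_of_bool)
    then show "mangoldt d * (real (2 * m div d) - 2 * real (m div d)) =
        mangoldt d * of_bool (odd (2 * m div d))"
      by simp
  qed
  also have "\<dots> \<le> (\<Sum>p | prime p \<and> s < p \<and> p \<le> 2 * m. of_bool (odd (2 * m div p)) * ln (real p))
      + real s * ln (real (2 * m))"
  proof -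
    define w :: "nat \<Rightarrow> real" where "w d = of_bool (odd (2 * m div d))" for d
    have "\<bar>(\<Sum>d=1..2 * m. mangoldt d * w d) - (\<Sum>p | prime p \<and> s < p \<and> p \<le> 2 * m. w p * ln (real p))\<bar>
        \<le> real s * ln (real (2 * m))"
      using assms by (intro sum_mangoldt_large_primes) (simp_all add: w_def)
    then show ?thesis
      unfolding w_def[symmetric] abs_le_iff by linarith
  qed
  finally show ?thesis .
qed

text \<open>Every multiple of \<open>p\<close> below \<open>p ^ 2\<close> contributes exactly one
  factor \<open>p\<close>.\<close>

lemma multiplicity_fact_large_prime:
  fixes p :: nat
  assumes "prime p" "n < p\<^sup>2"
  shows "multiplicity p (fact n :: nat) = n div p"
  using assms(2)
proof (induction n)
  case (Suc n)
  have "multiplicity p (Suc n) = of_bool (p dvd Suc n)"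
  proof (cases "p dvd Suc n")
    case True
    then have "multiplicity p (Suc n) \<ge> 1" 
      using assms(1) by (intro multiplicity_geI) auto
    moreover have "\<not> p ^ 2 dvd Suc n"
      using Suc.prems by (auto dest: dvd_imp_le)
    then have "multiplicity p (Suc n) < 2"
      using assms(1) by (intro multiplicity_lessI) auto
    ultimately show ?thesis
      using True by simp
  qed (simp add: not_dvd_imp_multiplicity_0)
  moreover have "multiplicity p (fact (Suc n) :: nat) = multiplicity p (Suc n) + multiplicity p (fact n :: nat)"
    using assms(1) by (subst fact_Suc) (simp add: prime_elem_multiplicity_mult_distrib del: mult_Suc)
  ultimately show ?case
    using Suc by (auto simp: div_Suc dvd_eq_mod_eq_0)
qed simp

lemma prime_dvd_central_binomial:
  assumes p: "prime p" "2 * m < p\<^sup>2" "odd (2 * m div p)"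
  shows "p dvd (2 * m) choose m"
proof (rule ccontr)
  assume not_dvd: "\<not> p dvd (2 * m) choose m"
  have "multiplicity p (fact (2 * m) :: nat) = multiplicity p (fact m * fact m * ((2 * m) choose m))"
    using binomial_fact_lemma[of m "2 * m"] by (simp add: mult_2)
  also have "\<dots> = 2 * multiplicity p (fact m :: nat)"
    using p(1) not_dvd by (simp add: prime_elem_multiplicity_mult_distrib not_dvd_imp_multiplicity_0)
  finally have "2 * m div p = 2 * (m div p)"
    using p by (simp add: multiplicity_fact_large_prime)
  then show False
    using p(3) by simp
qed

subsection \<open>The two ranges of indices\<close>

text \<open>The divisors range over an explicit list so that simplification can check them for
  numerals.\<close>

lemma prime_by_trial_division:
  assumes "p > 1" "p < k * k" "\<forall>d\<in>set [2..<k]. \<not> d dvd p"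
  shows "prime (p :: nat)"
proof (rule ccontr)
  assume "\<not> prime p"
  then obtain a where a: "a dvd p" "a \<noteq> 1" "a \<noteq> p"
    using assms(1) by (auto simp: prime_nat_iff)
  then obtain b where ab: "p = a * b"
    by (auto simp: dvd_def)
  have "a \<noteq> 0" "b \<noteq> 0" "b \<noteq> 1"
    using ab a(3) assms(1) by (auto intro: Nat.gr0I)
  then have gt: "1 < a" "1 < b"
    using a(2) by linarith+
  have "a < k \<or> b < k"
  proof (rule ccontr)
    assume "\<not> (a < k \<or> b < k)"
    then have "k * k \<le> a * b"
      by (intro mult_le_mono) auto
    then show False
      using ab assms(2) by simp
  qed
  moreover have "b dvd p"
    using ab by simp
  ultimately show False
    using gt a(1) bspec[OF assms(3), of a] bspec[OF assms(3), of b] by auto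
qed

text \<open>Such a \<open>p\<close> divides \<open>(2 * m)!\<close>, but neither \<open>m!\<close>
  nor \<open>m + 1\<close>, both of whose factors lie below \<open>p\<close>.\<close>

lemma prime_between_dvd_catalan:
  assumes "prime p" "p mod 6 = 5" "m + 1 < p" "p \<le> 2 * m"
  shows "\<exists>p. prime p \<and> p mod 6 = 5 \<and> p dvd catalan (m + 1)"
proof -
  have not_dvd: "\<not> p dvd fact m" "\<not> p dvd m + 1" and "p dvd fact (2 * m)"
    using assms by (auto simp: prime_dvd_fact_iff dest: dvd_imp_le)
  then have "p dvd fact m * fact m * ((2 * m) choose m)"
    using binomial_fact_lemma[of m "2 * m"] by (simp add: mult_2)
  then have "p dvd (m + 1) * catalan (m + 1)"
    using not_dvd(1) assms(1) catalan_mult[of "m + 1"] by (simp add: prime_dvd_mult_iff)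
  then have "p dvd catalan (m + 1)"
    using not_dvd(2) assms(1) prime_dvd_mult_iff by blast
  then show ?thesis
    using assms by blast
qed

lemma catalan_prime_small:
  assumes "6 \<le> m" "m < 48000"
  shows "\<exists>p. prime p \<and> p mod 6 = 5 \<and> p dvd catalan (m + 1)"
proof (rule ccontr)
  assume contra: "\<not> ?thesis"
  \<comment> \<open>As \<open>p\<close> cannot lie in \<open>(m + 1, 2 * m]\<close>, it is at most
    \<open>m + 1\<close>, which raises the lower bound for \<open>2 * m\<close> to
    \<open>2 * p - 2\<close>.\<close>
  have step: "q \<le> 2 * m" if "p \<le> 2 * m" "prime p" "p mod 6 = 5" "q + 2 \<le> 2 * p" for p q
    using prime_between_dvd_catalan[of p m] contra that by fastforce
  have trial: "q \<le> 2 * m"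
    if "p \<le> 2 * m" "\<forall>d\<in>set [2..<k]. \<not> d dvd p" "1 < p" "p < k * k" "p mod 6 = 5" "q + 2 \<le> 2 * p"
    for p k q
    using step that prime_by_trial_division by blast
  \<comment> \<open>All bounds before the last are primes congruent to 5 modulo 6, each at most
    twice its predecessor minus 2. The given \<open>k\<close> serves the trial division of the
    previous bound.\<close>
  have "11 \<le> 2 * m"
    using assms(1) by simp
  then have "17 \<le> 2 * m"
    by (rule trial[where k = 4]) simp_all
  then have "29 \<le> 2 * m"
    by (rule trial[where k = 5]) simp_all
  then have "53 \<le> 2 * m"
    by (rule trial[where k = 6]) simp_all
  then have "101 \<le> 2 * m"
    by (rule trial[where k = 8]) simp_all
  then have "197 \<le> 2 * m"
    by (rule trial[where k = 11]) simp_all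
  then have "389 \<le> 2 * m"
    by (rule trial[where k = 15]) simp_all
  then have "773 \<le> 2 * m"
    by (rule trial[where k = 20]) simp_all
  then have "1523 \<le> 2 * m"
    by (rule trial[where k = 28]) simp_all
  then have "3041 \<le> 2 * m"
    by (rule trial[where k = 40]) simp_all
  then have "6053 \<le> 2 * m"
    by (rule trial[where k = 56]) simp_all
  then have "12101 \<le> 2 * m"
    by (rule trial[where k = 78]) simp_all
  then have "24197 \<le> 2 * m"
    by (rule trial[where k = 111]) simp_all
  then have "48383 \<le> 2 * m"
    by (rule trial[where k = 156]) simp_all
  then have "96000 \<le> 2 * m"
    by (rule trial[where k = 220]) simp_all
  then show False
    using assms(2) by simp
qed

text \<open>
  \<open>37 / 198 = 1 - 1 / 2 - 2 / 9 - 1 / 11\<close> is what the Chebyshev bounds for \<open>N div p = 4\<close> (counted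
  twice), \<open>N div p \<ge> 9\<close> and \<open>N div p \<ge> 22\<close> leave of \<open>N * ln 2\<close>; here \<open>t\<close> is \<open>sqrt N\<close>.
\<close>

lemma ln_growth_bound:
  fixes t :: real
  assumes t: "t \<ge> 309"
  shows "(3 * t + 6) * ln (t\<^sup>2) < 37 / 198 * t\<^sup>2 * ln 2"
proof -
  define u where "u = t / 309"
  have u: "u \<ge> 1" "t = 309 * u"
    using t by (simp_all add: u_def)
  \<comment> \<open>309 is the integer part of \<open>sqrt 96000\<close>, the least
    \<open>sqrt N\<close> that occurs.\<close>
  have "ln ((309 :: real)\<^sup>2) \<le> ln (2 ^ 17)"
    by (subst ln_le_cancel_iff) auto
  then have "2 * ln (309 :: real) \<le> 17 * ln 2"
    by (simp only: ln_realpow)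
  then have "2 * ln 309 + 2 * ln u \<le> 17 * ln 2 + 2 * ln u"
    by (rule add_right_mono)
  moreover have "ln (t\<^sup>2) = 2 * ln 309 + 2 * ln u"
    using u by (simp only: ln_realpow) (simp add: ln_mult)
  ultimately have "ln (t\<^sup>2) \<le> 17 * ln 2 + 2 * ln u"
    by (simp only:)
  also have "\<dots> \<le> 17 * ln 2 + 2 * (u - 1) * (2 * ln 2)"
  proof -
    have "1 \<le> 2 * ln (2 :: real)"
      using ln_le_minus_one[of "1 / 2 :: real"] by (simp add: ln_div)
    then have "(u - 1) * 1 \<le> (u - 1) * (2 * ln 2)"
      using u by (intro mult_left_mono) auto
    then show ?thesis
      using ln_le_minus_one[of u] u by (simp add: algebra_simps)
  qed
  also have "\<dots> = (13 + 4 * u) * ln 2"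
    by (simp add: algebra_simps)
  also have "\<dots> \<le> (17 * u) * ln 2"
    using u by (intro mult_right_mono) auto
  \<comment> \<open>Here \<open>3 * t + 6 = 927 * u + 6 \<le> 933 * u\<close>; what remains is
    \<open>933 * 17 < 37 / 198 * 309 ^ 2\<close>.\<close>
  finally have "(3 * t + 6) * ln (t\<^sup>2) \<le> (933 * u) * (17 * u * ln 2)"
    using u t by (intro mult_mono ln_ge_zero one_le_power) auto
  also have "\<dots> < 37 / 198 * t\<^sup>2 * ln 2"
    using u by (simp add: power2_eq_square)
  finally show ?thesis .
qed

lemma catalan_prime_large:
  assumes "m \<ge> 48000"
  shows "\<exists>p. prime p \<and> p mod 6 = 5 \<and> p dvd catalan (m + 1)"
proof (rule ccontr)
  assume contra: "\<not> (\<exists>p. prime p \<and> p mod 6 = 5 \<and> p dvd catalan (m + 1))"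
  define N where "N = 2 * m"
  define s where "s = floor_sqrt N"
  define Q where "Q = {p. prime p \<and> s < p \<and> p \<le> N}"
  \<comment> \<open>\<open>c\<close> is the weight left to \<open>p\<close> in
    \<open>ln (N choose m)\<close> after subtracting both character sums; \<open>e\<close> is a
    majorant whose pieces are cheap to sum.\<close>
  define c :: "nat \<Rightarrow> real" where
    "c p = of_bool (odd (N div p)) - chi3 p * (chi3_sum (N div p) + chi3_sum (N div 3 div p))" for p
  define e :: "nat \<Rightarrow> real" where
    "e p = 3 * of_bool (p dvd m + 1) + 2 * of_bool (N div p = 4) + of_bool (9 \<le> N div p)
      + of_bool (22 \<le> N div p)" for p
  have N: "N > 0" "N < (s + 1)\<^sup>2" "s\<^sup>2 \<le> N" "N \<ge> 96000"
    using assms Suc_floor_sqrt_power2_gt[of N] by (auto simp: N_def s_def)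
  have s: "s \<ge> 309"
    using N(4) by (auto simp: s_def le_floor_sqrt_iff)
  have finQ: "finite Q"
    by (rule finite_subset[of _ "{..N}"]) (auto simp: Q_def)

  have c_le_e: "c p \<le> e p" if "p \<in> Q" for p
  proof -
    have "(s + 1)\<^sup>2 \<le> p\<^sup>2"
      using that by (intro power_mono) (auto simp: Q_def)
    with N(2) have "N < p\<^sup>2"
      by (rule less_le_trans)
    then have p: "prime p" "N < p\<^sup>2" "p > 3"
      using that s by (auto simp: Q_def)
    have p_mod: "p mod 2 \<noteq> 0" "p mod 3 \<noteq> 0"
      using p(1,3) primes_dvd_imp_eq[of 2 p] primes_dvd_imp_eq[of 3 p] by (auto simp flip: dvd_eq_mod_eq_0)
    define n where "n = N div p"
    have n_div: "N div 3 div p = n div 3"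
      by (simp add: n_def div_mult2_eq[symmetric] mult.commute)
    have c_eq: "c p = of_bool (odd n) - chi3 p * (chi3_sum n + chi3_sum (n div 3))"
      unfolding c_def n_div n_def ..
    have e_eq: "e p = 3 * of_bool (p dvd m + 1) + 2 * of_bool (n = 4) + of_bool (9 \<le> n)
        + of_bool (22 \<le> n)"
      unfolding e_def n_def ..
    \<comment> \<open>This is why \<open>N div 3\<close> is used: 1 and 7 are congruent to 1 modulo
      3, and 3 and 5 have quotient 1, so every odd \<open>n < 9\<close> is covered.\<close>
    have bound_pos: "of_bool (odd n) - (chi3_sum n + chi3_sum (n div 3)) \<le> (of_bool (9 \<le> n) :: real)"
      unfolding chi3_sum_def by (simp split: split_of_bool) presburger
    \<comment> \<open>Both summands are 1 exactly when \<open>n\<close> is 4 modulo 9; the even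
      cases start with 4 and 22. For the other even \<open>n < 9\<close> both vanish.\<close>
    have bound_even: "chi3_sum n + chi3_sum (n div 3) \<le>
        (2 * of_bool (n = 4) + of_bool (9 \<le> n) + of_bool (22 \<le> n) :: real)" if "even n"
      unfolding chi3_sum_def using that by (simp split: split_of_bool) presburger
    have even_n: "even n" if "p mod 3 = 2" "\<not> p dvd m + 1"
    proof (rule ccontr)
      assume "odd n"
      then have "p dvd (2 * m) choose m"
        using p by (intro prime_dvd_central_binomial) (auto simp: n_def N_def)
      then have "p dvd (m + 1) * catalan (m + 1)"
        using catalan_mult[of "m + 1"] by simp
      then have "p dvd catalan (m + 1)"
        using p(1) that(2) prime_dvd_mult_iff by blast
      moreover have "p mod 6 = 5"
        using that(1) p_mod(1) by presburger
      ultimately show False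
        using contra p(1) by blast
    qed
    have "chi3_sum k \<le> 1" for k
      by (simp add: chi3_sum_def)
    from this[of n] this[of "n div 3"] have bound_dvd: "chi3_sum n + chi3_sum (n div 3) \<le> 2"
      by simp
    consider "p mod 3 = 1" | "p mod 3 = 2" "p dvd m + 1" | "p mod 3 = 2" "\<not> p dvd m + 1"
      using p_mod(2) by linarith
    then show ?thesis
    proof cases
      case 1
      then have "c p \<le> of_bool (9 \<le> n)"
        using bound_pos by (simp add: c_eq chi3_def)
      also have "\<dots> \<le> e p"
        by (simp add: e_eq)
      finally show ?thesis .
    next
      case 2
      then have "c p \<le> 3"
        using bound_dvd by (simp add: c_eq chi3_def)
      also have "\<dots> \<le> e p"
        using 2 by (simp add: e_eq)
      finally show ?thesis .
    next
      case 3
      then have "c p = chi3_sum n + chi3_sum (n div 3)"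
        using even_n by (simp add: c_eq chi3_def)
      also have "\<dots> \<le> 2 * of_bool (n = 4) + of_bool (9 \<le> n) + of_bool (22 \<le> n)"
        using even_n 3 by (intro bound_even)
      also have "\<dots> \<le> e p"
        by (simp add: e_eq)
      finally show ?thesis .
    qed
  qed

  have ln_nonneg: "ln (real p) \<ge> 0" if "p \<in> Q" for p
    using that by (auto simp: Q_def dest: prime_gt_0_nat)
  have restrict: "(\<Sum>p\<in>Q. of_bool (P p) * ln (real p)) = (\<Sum>p\<in>{p\<in>Q. P p}. ln (real p))" for P
    using finQ by (simp add: sum.inter_filter of_bool_def if_distrib[of "\<lambda>x. x * _"] cong: if_cong)
  have sum_dvd: "(\<Sum>p\<in>Q. of_bool (p dvd m + 1) * ln (real p)) \<le> ln (real N)"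
  proof -
    have "(\<Sum>p\<in>Q. of_bool (p dvd m + 1) * ln (real p)) \<le> ln (real (m + 1))"
      unfolding restrict by (intro sum_ln_primes_dvd_le) (auto simp: Q_def)
    also have "\<dots> \<le> ln (real N)"
      using assms by (subst ln_le_cancel_iff) (auto simp: N_def)
    finally show ?thesis .
  qed
  have sum_4: "(\<Sum>p\<in>Q. of_bool (N div p = 4) * ln (real p)) \<le> real N / 8 * ln 4"
  proof -
    \<comment> \<open>Placing these primes in one doubling interval costs
      \<open>N / 8 * ln 4\<close>, half of what Chebyshev's bound up to \<open>N / 4\<close> would
      give.\<close>
    have "p \<le> 2 * (N div 8) + 1" "N div 8 + 1 < p" if "N div p = 4" "p > 0" for p
    proof -
      have "4 * p \<le> N" "N < 5 * p"
        using that div_times_less_eq_dividend[of N p] dividend_less_div_times[of p N] by auto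
      then show "p \<le> 2 * (N div 8) + 1" "N div 8 + 1 < p"
        using N(4) by linarith+
    qed
    then have "(\<Sum>p\<in>Q. of_bool (N div p = 4) * ln (real p)) \<le>
        (\<Sum>p | prime p \<and> N div 8 + 1 < p \<and> p \<le> 2 * (N div 8) + 1. ln (real p))"
      unfolding restrict by (intro sum_mono2) (auto simp: Q_def prime_gt_0_nat Suc_le_eq)
    also have "\<dots> \<le> real (N div 8) * ln 4"
      by (rule sum_ln_primes_doubling_le)
    also have "\<dots> \<le> real N / 8 * ln 4"
      using of_nat_div_le_of_nat[of N 8] by (intro mult_right_mono) auto
    finally show ?thesis .
  qed
  have sum_ge: "(\<Sum>p\<in>Q. of_bool (k \<le> N div p) * ln (real p)) \<le> real N / real k * ln 4" if "k > 0" for k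
  proof -
    have "(\<Sum>p\<in>Q. of_bool (k \<le> N div p) * ln (real p)) \<le> (\<Sum>p | prime p \<and> p \<le> N div k. ln (real p))"
      unfolding restrict
    proof (intro sum_mono2)
      show "{p \<in> Q. k \<le> N div p} \<subseteq> {p. prime p \<and> p \<le> N div k}"
        using that by (auto simp: Q_def prime_gt_0_nat less_eq_div_iff_mult_less_eq mult.commute)
    qed (auto simp: prime_gt_0_nat Suc_le_eq)
    also have "\<dots> \<le> real (N div k) * ln 4"
      by (rule sum_ln_primes_le)
    also have "\<dots> \<le> real N / real k * ln 4"
      using of_nat_div_le_of_nat[of N k] by (intro mult_right_mono) auto
    finally show ?thesis .
  qed

  have "real N * ln 2 - ln (real N) = ln (4 ^ m / (2 * real m))"
    using assms ln_realpow[of 2 2] by (simp add: N_def ln_div ln_realpow)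
  also have "\<dots> \<le> ln (real ((2 * m) choose m))"
    using central_binomial_lower_bound[of m] assms by (subst ln_le_cancel_iff) auto
  also have "\<dots> \<le> (\<Sum>p\<in>Q. of_bool (odd (N div p)) * ln (real p)) + real s * ln (real N)"
    using ln_central_binomial_le[of m s] N assms by (simp add: N_def Q_def)
  also have "(\<Sum>p\<in>Q. of_bool (odd (N div p)) * ln (real p)) = (\<Sum>p\<in>Q. c p * ln (real p))
      + (\<Sum>p\<in>Q. chi3 p * chi3_sum (N div p) * ln (real p))
      + (\<Sum>p\<in>Q. chi3 p * chi3_sum (N div 3 div p) * ln (real p))"
    unfolding sum.distrib[symmetric] by (intro sum.cong) (auto simp: c_def algebra_simps)
  also have "(\<Sum>p\<in>Q. chi3 p * chi3_sum (N div p) * ln (real p)) \<le> (real s + 1) * ln (real N)"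
    using N unfolding Q_def by (intro sum_chi3_primes_le) auto
  also have "(\<Sum>p\<in>Q. chi3 p * chi3_sum (N div 3 div p) * ln (real p)) \<le> (real s + 1) * ln (real N)"
    using N unfolding Q_def by (intro sum_chi3_primes_le) auto
  also have "(\<Sum>p\<in>Q. c p * ln (real p)) \<le> (\<Sum>p\<in>Q. e p * ln (real p))"
    using c_le_e ln_nonneg by (intro sum_mono mult_right_mono)
  also have "\<dots> = 3 * (\<Sum>p\<in>Q. of_bool (p dvd m + 1) * ln (real p))
      + 2 * (\<Sum>p\<in>Q. of_bool (N div p = 4) * ln (real p))
      + (\<Sum>p\<in>Q. of_bool (9 \<le> N div p) * ln (real p))
      + (\<Sum>p\<in>Q. of_bool (22 \<le> N div p) * ln (real p))"
    unfolding sum_distrib_left sum.distrib[symmetric]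
    by (intro sum.cong) (simp_all add: e_def algebra_simps)
  also have "\<dots> \<le> 3 * ln (real N) + 2 * (real N / 8 * ln 4) + real N / 9 * ln 4 + real N / 22 * ln 4"
    using sum_dvd sum_4 sum_ge[of 9] sum_ge[of 22] by simp
  \<comment> \<open>The multiples of \<open>ln N\<close> are 1 from the lower bound,
    \<open>s\<close> from the binomial, \<open>2 * (s + 1)\<close> from the characters and 3 from
    the divisors of \<open>m + 1\<close>.\<close>
  finally have "37 / 198 * real N * ln 2 \<le> (3 * real s + 6) * ln (real N)"
    using ln_realpow[of 2 2] by (simp add: algebra_simps)
  moreover define t where "t = sqrt (real N)"
  have t: "t\<^sup>2 = real N" "real s \<le> t"
    using N(3) by (auto simp: t_def intro!: real_le_rsqrt simp flip: of_nat_power)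
  have "(3 * real s + 6) * ln (real N) \<le> (3 * t + 6) * ln (real N)"
    using t N by (intro mult_right_mono) auto
  moreover have "(3 * t + 6) * ln (t\<^sup>2) < 37 / 198 * t\<^sup>2 * ln 2"
    using t s by (intro ln_growth_bound) simp
  ultimately show False
    using t by simp
qed

theorem theorem1:
  fixes n :: nat
  assumes "n > 6"
  shows "\<exists>p k :: nat. k > 0 \<and> p = 6 * k - 1 \<and> prime p \<and> p dvd catalan n"
proof -
  have "\<exists>p. prime p \<and> p mod 6 = 5 \<and> p dvd catalan (n - 1 + 1)"
  proof (cases "n - 1 < 48000")
    case True
    then show ?thesis
      using assms by (intro catalan_prime_small) auto
  next
    case False
    then show ?thesis
      by (intro catalan_prime_large) auto
  qed
  moreover have "n - 1 + 1 = n"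
    using assms by simp
  ultimately obtain p where p: "prime p" "p mod 6 = 5" "p dvd catalan n"
    by (simp only:) blast
  have "p = 6 * (p div 6 + 1) - 1"
    using p(2) by presburger
  then show ?thesis
    using p by (intro exI[of _ p] exI[of _ "p div 6 + 1"]) auto
qed

end
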